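(* Let $p$ be a prime and let $a\in\mathbb Z_p^{\mathbb N}$ be a sequence of $p$-adic integers such that $a_\alpha:=a \bmod p^\alpha$ is $p$-automatic for each $\alpha\ge0$. For each $\alpha\ge 0$ let $\mathcal M_\alpha=(\mathcal S_\alpha,\Sigma_p,\delta_\alpha,\overline s_\alpha,\mathbb Z/(p^\alpha\mathbb Z),\tau_\alpha)$ be the minimal automaton generating $a_\alpha$ in direct reading, let $u_\alpha=(\delta_\alpha(\overline s_\alpha,\mathrm{rep}_p(n)))_{n\ge0}\in\mathcal S_\alpha^{\mathbb N}$, and let $\mathcal S=\varprojlim\mathcal S_\alpha$ be the state set of the profinite automaton that is the inverse limit of $(\mathcal M_\alpha)_{\alpha\ge0}$. Then there are a sequence $u\in\mathcal S^{\mathbb N}$, generated by this profinite automaton, and a letter-to-letter projection $\tau:X_u\to X_a$ with $\tau(u)=a$, such that for each $0\le\alpha\le\beta$ the maps (all applied termwise) $$\psi_{\alpha,\infty}:X_u\to X_{u_\alpha},\quad \psi_{\beta,\infty}:X_u\to X_{u_\beta},\quad \psi_{\alpha,\beta}:X_{u_\beta}\to X_{u_\alpha},\quad \tau_\alpha:X_{u_\alpha}\to X_{a_\alpha},\quad \tau_\beta:X_{u_\beta}\to X_{a_\beta},$$ $$\pi_{\alpha,\infty}:X_a\to X_{a_\alpha},\quad \pi_{\beta,\infty}:X_a\to X_{a_\beta},\quad \pi_{\alpha,\beta}:X_{a_\beta}\to X_{a_\alpha}$$ are well defined between the indicated spaces, these maps and $\tau$ commute with the shift map $\sigma$, and they satisfy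 $\psi_{\alpha,\infty}=\psi_{\alpha,\beta}\circ\psi_{\beta,\infty}$, $\pi_{\alpha,\infty}=\pi_{\alpha,\beta}\circ\pi_{\beta,\infty}$, $\pi_{\alpha,\beta}\circ\tau_\beta=\tau_\alpha\circ\psi_{\alpha,\beta}$, $\pi_{\alpha,\infty}\circ\tau=\tau_\alpha\circ\psi_{\alpha,\infty}$ and $\pi_{\beta,\infty}\circ\tau=\tau_\beta\circ\psi_{\beta,\infty}$.
   Context: $\Sigma_p=\{0,\dots,p-1\}$. A $p$-DAO is a tuple $(\mathcal S,\Sigma_p,\delta,\overline s,\mathcal A,\tau)$ with state set $\mathcal S$, initial state $\overline s$, transition function $\delta:\mathcal S\times\Sigma_p\to\mathcal S$ (extended to words by $\delta(s,\epsilon)=s$, $\delta(s,n_\ell\cdots n_0)=\delta(\delta(s,n_\ell),n_{\ell-1}\cdots n_0)$) and output function $\tau:\mathcal S\to\mathcal A$; it is finite if $\mathcal S$ is finite. $\mathrm{rep}_p(n)$ is the standard base-$p$ representation of $n$, most significant digit first, without leading zeros ($\mathrm{rep}_p(0)=\epsilon$). A sequence $b$ is $p$-automatic if $b(n)=\tau(\delta(\overline s,\mathrm{rep}_p(n)))$ for all $n\ge 0$ for some finite $p$-DAO; the automaton then generates $b$ in direct reading. The minimal automaton generating $b$ is the finite $p$-DAO with fewest states (unique up to renaming) whose function $w\mapsto\tau(\delta(\overline s,w))$ on $\Sigma_p^*$ is $n_\ell\cdots n_0\mapsto b(n_\ell p^\ell+\dots+n_0)$ (leading zeros ignored). For $0\le\alpha\le\beta$,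 $\pi_{\alpha,\beta}:\mathbb Z/(p^\beta\mathbb Z)\to\mathbb Z/(p^\alpha\mathbb Z)$ and $\pi_{\alpha,\infty}:\mathbb Z_p\to\mathbb Z/(p^\alpha\mathbb Z)$ are the natural projections. For minimal automata $\mathcal M_\alpha$ generating $a_\alpha$ there are maps $\psi_{\alpha,\beta}:\mathcal S_\beta\to\mathcal S_\alpha$ with $\psi_{\alpha,\beta}(\overline s_\beta)=\overline s_\alpha$, $\psi_{\alpha,\beta}(\delta_\beta(s,i))=\delta_\alpha(\psi_{\alpha,\beta}(s),i)$, $\pi_{\alpha,\beta}(\tau_\beta(s))=\tau_\alpha(\psi_{\alpha,\beta}(s))$ for $s\in\mathcal S_\beta$, $i\in\Sigma_p$, and $\psi_{\alpha,\gamma}=\psi_{\alpha,\beta}\circ\psi_{\beta,\gamma}$ for $\alpha\le\beta\le\gamma$; these are the maps used. The profinite automaton that is the inverse limit of $(\mathcal M_\alpha)$ is $(\mathcal S,\Sigma_p,\delta,\overline s,\mathbb Z_p,\tau)$ with $\mathcal S=\{(s_\alpha)_{\alpha\ge0}\in\prod_\alpha\mathcal S_\alpha:\psi_{\alpha,\beta}(s_\beta)=s_\alpha\text{ for all }0\le\alpha\le\beta\}$, $\overline s=(\overline s_\alpha)_\alpha$, $(\delta(s,i))_\alpha=\delta_\alpha(s_\alpha,i)$, and $\pi_{\alpha,\infty}(\tau(s))=\tau_\alpha(s_\alpha)$ for all $\alpha$. The map $\psi_{\alpha,\infty}:\mathcal S\to\mathcal S_\alpha$ is $s\mapsto s_\alpha$.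 The sequence in $\mathcal S^{\mathbb N}$ generated by this automaton is $(\delta(\overline s,\mathrm{rep}_p(n)))_{n\ge 0}$. Finite alphabets carry the discrete topology, $\mathcal S$ the inverse limit topology (subspace of the product), $\mathbb Z_p$ the $p$-adic topology, and $\mathcal A^{\mathbb N}$ the product topology. $\sigma$ is the shift $\sigma((x(n))_{n\ge0})=(x(n+1))_{n\ge0}$, and for $x\in\mathcal A^{\mathbb N}$, $X_x$ is the closure of $\{\sigma^n(x):n\in\mathbb N\}$ in $\mathcal A^{\mathbb N}$. A letter-to-letter projection is a map on sequences obtained by applying a fixed map of alphabets (here $\mathcal S\to\mathbb Z_p$) to each term. *)

theory Defs
  imports "HOL-Analysis.Analysis" "HOL-Computational_Algebra.Primes"
begin

text \<open>Words are lists of digits, most significant digit first.\<close>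

definition words :: "nat \<Rightarrow> nat list set" where
  "words p = lists {..<p}"

text \<open>The test \<open>p < 2\<close> only serves termination; for \<open>p \<ge> 2\<close> this is the usual recursion.\<close>

fun rep :: "nat \<Rightarrow> nat \<Rightarrow> nat list" where
  "rep p n = (if n = 0 \<or> p < 2 then [] else rep p (n div p) @ [n mod p])"

declare rep.simps [simp del]

text \<open>The value of \<open>n\<^sub>l \<dots> n\<^sub>0\<close> is \<open>n\<^sub>l p\<^sup>l + \<dots> + n\<^sub>0\<close>, whether or not there are leading zeros.\<close>

definition word_val :: "nat \<Rightarrow> nat list \<Rightarrow> nat" where
  "word_val p w = (\<Sum>i<length w. rev w ! i * p ^ i)"

record ('s, 'b) dao =
  states :: "'s set"
  trans :: "'s \<Rightarrow> nat \<Rightarrow> 's"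
  initial :: 's
  alphabet :: "'b set"
  out :: "'s \<Rightarrow> 'b"

definition is_dao :: "nat \<Rightarrow> ('s, 'b) dao \<Rightarrow> bool" where
  "is_dao p D \<longleftrightarrow>
     initial D \<in> states D \<and>
     (\<forall>s \<in> states D. \<forall>i < p. trans D s i \<in> states D) \<and>
     (\<forall>s \<in> states D. out D s \<in> alphabet D)"

definition finite_dao :: "nat \<Rightarrow> ('s, 'b) dao \<Rightarrow> bool" where
  "finite_dao p D \<longleftrightarrow> is_dao p D \<and> finite (states D)"

definition run :: "('s, 'b) dao \<Rightarrow> 's \<Rightarrow> nat list \<Rightarrow> 's" where
  "run D s w = foldl (trans D) s w"

definition state_seq :: "nat \<Rightarrow> ('s, 'b) dao \<Rightarrow> nat \<Rightarrow> 's" where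
  "state_seq p D n = run D (initial D) (rep p n)"

text \<open>Finite state sets can be renamed into \<^typ>\<open>nat\<close>, so it is no restriction that this definition
  and the minimality condition below quantify over automata with states of type \<^typ>\<open>nat\<close>.\<close>

definition p_automatic :: "nat \<Rightarrow> (nat \<Rightarrow> 'b) \<Rightarrow> bool" where
  "p_automatic p b \<longleftrightarrow>
     (\<exists>D :: (nat, 'b) dao. finite_dao p D \<and> (\<forall>n. b n = out D (state_seq p D n)))"

definition computes :: "nat \<Rightarrow> (nat \<Rightarrow> 'b) \<Rightarrow> ('s, 'b) dao \<Rightarrow> bool" where
  "computes p b D \<longleftrightarrow>
     finite_dao p D \<and> (\<forall>w \<in> words p. out D (run D (initial D) w) = b (word_val p w))"

definition minimal_automaton :: "nat \<Rightarrow> (nat \<Rightarrow> 'b) \<Rightarrow> ('s, 'b) dao \<Rightarrow> bool" where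
  "minimal_automaton p b D \<longleftrightarrow>
     computes p b D \<and>
     (\<forall>D' :: (nat, 'b) dao. computes p b D' \<longrightarrow> card (states D) \<le> card (states D'))"

text \<open>Residue classes modulo \<open>p ^ \<alpha>\<close> are given by their least nonnegative representatives. Hence
  the projection from residues modulo \<open>p ^ \<beta>\<close> to residues modulo \<open>p ^ \<alpha>\<close> does not mention \<open>\<beta>\<close>.\<close>

definition zmod :: "nat \<Rightarrow> nat \<Rightarrow> int set" where
  "zmod p \<alpha> = {0..<int p ^ \<alpha>}"

definition zmod_proj :: "nat \<Rightarrow> nat \<Rightarrow> int \<Rightarrow> int" where
  "zmod_proj p \<alpha> z = z mod int p ^ \<alpha>"

text \<open>A p-adic integer is the coherent sequence of its residues modulo \<open>p ^ \<alpha>\<close>.\<close>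

definition padic_ints :: "nat \<Rightarrow> (nat \<Rightarrow> int) set" where
  "padic_ints p =
     {x. (\<forall>\<alpha>. x \<alpha> \<in> zmod p \<alpha>) \<and> (\<forall>\<alpha> \<beta>. \<alpha> \<le> \<beta> \<longrightarrow> zmod_proj p \<alpha> (x \<beta>) = x \<alpha>)}"

definition padic_proj :: "nat \<Rightarrow> (nat \<Rightarrow> int) \<Rightarrow> int" where
  "padic_proj \<alpha> x = x \<alpha>"

text \<open>The p-adic metric \<open>p powr - v (x - y)\<close>: the valuation \<open>v (x - y)\<close> is the largest \<open>n\<close>
  with \<open>x \<equiv> y\<close> modulo \<open>p ^ n\<close>.\<close>

definition padic_dist :: "nat \<Rightarrow> (nat \<Rightarrow> int) \<Rightarrow> (nat \<Rightarrow> int) \<Rightarrow> real" where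
  "padic_dist p x y = (if x = y then 0 else 1 / real p ^ (GREATEST n. x n = y n))"

definition padic_topology :: "nat \<Rightarrow> (nat \<Rightarrow> int) topology" where
  "padic_topology p = Metric_space.mtopology (padic_ints p) (padic_dist p)"

definition connecting_maps ::
  "nat \<Rightarrow> (nat \<Rightarrow> ('s, int) dao) \<Rightarrow> (nat \<Rightarrow> nat \<Rightarrow> 's \<Rightarrow> 's) \<Rightarrow> bool" where
  "connecting_maps p M \<psi> \<longleftrightarrow>
     (\<forall>\<alpha> \<beta>. \<alpha> \<le> \<beta> \<longrightarrow>
        \<psi> \<alpha> \<beta> \<in> states (M \<beta>) \<rightarrow> states (M \<alpha>) \<and>
        \<psi> \<alpha> \<beta> (initial (M \<beta>)) = initial (M \<alpha>) \<and>
        (\<forall>s \<in> states (M \<beta>). \<forall>i < p. \<psi> \<alpha> \<beta> (trans (M \<beta>) s i) = trans (M \<alpha>) (\<psi> \<alpha> \<beta> s) i) \<and>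
        (\<forall>s \<in> states (M \<beta>). zmod_proj p \<alpha> (out (M \<beta>) s) = out (M \<alpha>) (\<psi> \<alpha> \<beta> s))) \<and>
     (\<forall>\<alpha> \<beta> \<gamma>. \<alpha> \<le> \<beta> \<longrightarrow> \<beta> \<le> \<gamma> \<longrightarrow>
        (\<forall>s \<in> states (M \<gamma>). \<psi> \<alpha> \<gamma> s = \<psi> \<alpha> \<beta> (\<psi> \<beta> \<gamma> s)))"

text \<open>The output of a state \<open>s\<close> of the inverse limit is the p-adic integer whose residue
  modulo \<open>p ^ \<alpha>\<close> is the output of \<open>s \<alpha>\<close>.\<close>

definition inverse_limit ::
  "nat \<Rightarrow> (nat \<Rightarrow> ('s, int) dao) \<Rightarrow> (nat \<Rightarrow> nat \<Rightarrow> 's \<Rightarrow> 's) \<Rightarrow> (nat \<Rightarrow> 's, nat \<Rightarrow> int) dao" where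
  "inverse_limit p M \<psi> =
     \<lparr>states = {s. (\<forall>\<alpha>. s \<alpha> \<in> states (M \<alpha>)) \<and> (\<forall>\<alpha> \<beta>. \<alpha> \<le> \<beta> \<longrightarrow> \<psi> \<alpha> \<beta> (s \<beta>) = s \<alpha>)},
      trans = (\<lambda>s i \<alpha>. trans (M \<alpha>) (s \<alpha>) i),
      initial = (\<lambda>\<alpha>. initial (M \<alpha>)),
      alphabet = padic_ints p,
      out = (\<lambda>s \<alpha>. out (M \<alpha>) (s \<alpha>))\<rparr>"

definition psi_inf :: "nat \<Rightarrow> (nat \<Rightarrow> 's) \<Rightarrow> 's" where
  "psi_inf \<alpha> s = s \<alpha>"

definition limit_topology ::
  "nat \<Rightarrow> (nat \<Rightarrow> ('s, int) dao) \<Rightarrow> (nat \<Rightarrow> nat \<Rightarrow> 's \<Rightarrow> 's) \<Rightarrow> (nat \<Rightarrow> 's) topology" where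
  "limit_topology p M \<psi> =
     subtopology (product_topology (\<lambda>\<alpha>. discrete_topology (states (M \<alpha>))) UNIV)
       (states (inverse_limit p M \<psi>))"

definition shift :: "(nat \<Rightarrow> 'a) \<Rightarrow> nat \<Rightarrow> 'a" where
  "shift x n = x (Suc n)"

text \<open>The space \<open>X\<^sub>x\<close>; the alphabet and its topology are given by the first argument.\<close>

definition shift_space :: "'a topology \<Rightarrow> (nat \<Rightarrow> 'a) \<Rightarrow> (nat \<Rightarrow> 'a) set" where
  "shift_space T x =
     product_topology (\<lambda>_::nat. T) UNIV closure_of range (\<lambda>n. (shift ^^ n) x)"

definition termwise :: "('a \<Rightarrow> 'b) \<Rightarrow> (nat \<Rightarrow> 'a) \<Rightarrow> nat \<Rightarrow> 'b" where
  "termwise f x n = f (x n)"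

definition letter_to_letter :: "'a set \<Rightarrow> 'b set \<Rightarrow> ((nat \<Rightarrow> 'a) \<Rightarrow> nat \<Rightarrow> 'b) \<Rightarrow> bool" where
  "letter_to_letter A B F \<longleftrightarrow> (\<exists>f \<in> A \<rightarrow> B. F = termwise f)"

definition commutes_with_shift :: "(nat \<Rightarrow> 'a) set \<Rightarrow> ((nat \<Rightarrow> 'a) \<Rightarrow> nat \<Rightarrow> 'b) \<Rightarrow> bool" where
  "commutes_with_shift X F \<longleftrightarrow> (\<forall>x \<in> X. F (shift x) = shift (F x))"

lemma padic_agree_below:
  assumes "x \<in> padic_ints p" "y \<in> padic_ints p" "x n = y n" "m \<le> n"
  shows "x m = y m"
  using assms unfolding padic_ints_def by (metis (mono_tags, lifting) mem_Collect_eq)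

lemma padic_greatest:
  assumes "x \<in> padic_ints p" "y \<in> padic_ints p" "x \<noteq> y"
  shows "x n = y n \<longleftrightarrow> n \<le> (GREATEST n. x n = y n)"
proof -
  obtain k where k: "x k \<noteq> y k" using assms(3) by blast
  have bd: "\<And>n. x n = y n \<Longrightarrow> n \<le> k"
    using padic_agree_below[OF assms(1,2)] k by (meson nat_le_linear)
  have "x 0 = y 0" using assms(1,2) by (auto simp: padic_ints_def zmod_def dest!: spec[of _ 0])
  then have "x (GREATEST n. x n = y n) = y (GREATEST n. x n = y n)"
    using bd by (rule GreatestI_nat)
  then show ?thesis
    using padic_agree_below[OF assms(1,2)] Greatest_le_nat[of "\<lambda>n. x n = y n", OF _ bd] by blast
qed

lemma padic_Metric_space:
  assumes "prime p"
  shows "Metric_space (padic_ints p) (padic_dist p)"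
proof
  have p: "real p > 1" using prime_gt_1_nat[OF assms] by simp
  show "0 \<le> padic_dist p x y" for x y by (simp add: padic_dist_def)
  show "padic_dist p x y = padic_dist p y x" for x y by (simp add: padic_dist_def eq_commute)
  show "(padic_dist p x y = 0) = (x = y)" for x y using p by (simp add: padic_dist_def)
  show "padic_dist p x z \<le> padic_dist p x y + padic_dist p y z"
    if m: "x \<in> padic_ints p" "y \<in> padic_ints p" "z \<in> padic_ints p" for x y z
  proof (cases "x = y \<or> y = z \<or> x = z")
    case True
    then show ?thesis by (auto simp: padic_dist_def)
  next
    case False
    define v where "v = (\<lambda>x y. GREATEST n. (x::nat \<Rightarrow> int) n = y n)"
    have d: "padic_dist p a b = 1 / real p ^ v a b" if "a \<noteq> b" for a b
      using that by (simp add: padic_dist_def v_def)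
    have g: "a n = b n \<longleftrightarrow> n \<le> v a b"
      if "a \<in> padic_ints p" "b \<in> padic_ints p" "a \<noteq> b" for a b n
      unfolding v_def using padic_greatest[OF that] .
    have "min (v x y) (v y z) \<le> v x z"
      using g[OF m(1,2)] g[OF m(2,3)] g[OF m(1,3)] False
      by (metis min.cobounded1 min.cobounded2)
    then have "v x y \<le> v x z \<or> v y z \<le> v x z" by linarith
    then have "1 / real p ^ v x z \<le> 1 / real p ^ v x y \<or> 1 / real p ^ v x z \<le> 1 / real p ^ v y z"
      using p by (auto intro!: divide_left_mono power_increasing)
    moreover have "1 / real p ^ v x y \<ge> 0" "1 / real p ^ v y z \<ge> 0" by simp_all
    ultimately show ?thesis using d False by (smt (verit))
  qed
qed

lemma run_append: "run D s (v @ w) = run D (run D s v) w"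
  by (simp add: run_def)

lemma run_in_states:
  assumes "is_dao p D" "w \<in> words p" "s \<in> states D"
  shows "run D s w \<in> states D"
  using assms(2,3)
proof (induction w arbitrary: s)
  case (Cons i w)
  then show ?case using assms(1) by (auto simp: is_dao_def run_def words_def)
qed (simp add: run_def)

lemma minimal_reachable_separated:
  fixes D :: "('s, 'b) dao"
  assumes "minimal_automaton p b D"
  shows "s \<in> states D \<Longrightarrow> \<exists>w \<in> words p. s = run D (initial D) w"
    and "s \<in> states D \<Longrightarrow> t \<in> states D \<Longrightarrow>
      (\<And>v. v \<in> words p \<Longrightarrow> out D (run D s v) = out D (run D t v)) \<Longrightarrow> s = t"
proof -
  have D: "is_dao p D" "finite (states D)"
    and cw: "\<And>w. w \<in> words p \<Longrightarrow> out D (run D (initial D) w) = b (word_val p w)"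
    and mini: "\<And>D' :: (nat, 'b) dao. computes p b D' \<Longrightarrow> card (states D) \<le> card (states D')"
    using assms by (auto simp: minimal_automaton_def computes_def finite_dao_def)
  define G where "G s = (\<lambda>v. if v \<in> words p then out D (run D s v) else undefined)" for s
  define R where "R = run D (initial D) ` words p"
  define Q where "Q = G ` R"
  have RS: "R \<subseteq> states D" using run_in_states[OF D(1)] D(1) by (auto simp: R_def is_dao_def)
  then have finR: "finite R" using D(2) finite_subset by blast
  then have finQ: "finite Q" by (simp add: Q_def)
  obtain e :: "(nat list \<Rightarrow> 'b) \<Rightarrow> nat" where e: "inj_on e Q"
    using finite_imp_inj_to_nat_seg[OF finQ] by blast
  define step where "step q i = (\<lambda>v. if v \<in> words p then q (i # v) else undefined)"
    for q :: "nat list \<Rightarrow> 'b" and i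
  define N where "N = \<lparr>states = e ` Q, trans = (\<lambda>k i. e (step (inv_into Q e k) i)),
     initial = e (G (initial D)), alphabet = UNIV, out = (\<lambda>k. inv_into Q e k [])\<rparr>"
  have nil: "[] \<in> words p" by (simp add: words_def)
  have iR: "initial D \<in> R" using nil by (auto simp: R_def run_def image_iff intro!: bexI[of _ "[]"])
  have sR: "run D s w \<in> R" if "s \<in> R" "w \<in> words p" for s w
  proof -
    obtain x where x: "x \<in> words p" "s = run D (initial D) x" using \<open>s \<in> R\<close> by (auto simp: R_def)
    have "x @ w \<in> words p" using x(1) \<open>w \<in> words p\<close> by (auto simp: words_def)
    then show ?thesis unfolding R_def x(2) run_append[symmetric] by (rule imageI)
  qed
  have stepG: "step (G s) i = G (run D s [i])" if "i < p" for s i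
    using that by (auto simp: step_def G_def fun_eq_iff words_def run_def)
  have tr: "trans N (e (G s)) i = e (G (run D s [i]))" if "s \<in> R" "i < p" for s i
    using that e by (simp add: N_def Q_def stepG)
  have rN: "run N (e (G s)) w = e (G (run D s w))" if "s \<in> R" "w \<in> words p" for s w
    using that
  proof (induction w arbitrary: s)
    case (Cons i w)
    have i: "i < p" "w \<in> words p" using Cons.prems by (auto simp: words_def)
    have "[i] \<in> words p" using i by (simp add: words_def)
    then show ?case using Cons.IH[OF sR[of s "[i]"] i(2)] tr[OF Cons.prems(1) i(1)] Cons.prems(1)
      by (simp add: run_def)
  qed (simp add: run_def)
  have oN: "out N (e (G s)) = out D s" if "s \<in> R" for s
    using that e nil by (simp add: N_def Q_def G_def run_def)
  have "computes p b N"
    unfolding computes_def finite_dao_def is_dao_def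
  proof (intro conjI ballI allI impI)
    show "initial N \<in> states N" using iR by (auto simp: N_def Q_def)
    show "finite (states N)" using finQ by (simp add: N_def)
  next
    fix k i assume k: "k \<in> states N" and i: "i < p"
    from k obtain s where s: "s \<in> R" "k = e (G s)" by (auto simp: N_def Q_def)
    have "[i] \<in> words p" using i by (simp add: words_def)
    then show "trans N k i \<in> states N"
      using tr[OF s(1) i] sR[OF s(1)] s(2) by (auto simp: N_def Q_def)
  next
    fix w assume w: "w \<in> words p"
    have "initial N = e (G (initial D))" by (simp add: N_def)
    then show "out N (run N (initial N) w) = b (word_val p w)"
      using rN[OF iR w] oN[OF sR[OF iR w]] cw[OF w] by simp
  qed (simp add: N_def)
  then have "card (states D) \<le> card (states N)" by (rule mini)
  also have "card (states N) = card Q" using e by (simp add: N_def card_image)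
  finally have c: "card (states D) \<le> card Q" .
  have "card Q \<le> card R" unfolding Q_def using finR by (rule card_image_le)
  then have RD: "R = states D" using card_seteq[OF D(2) RS] c by linarith
  have "card (G ` states D) = card (states D)"
    using c card_image_le[OF D(2), of G] RD by (simp add: Q_def)
  then have inj: "inj_on G (states D)" using D(2) eq_card_imp_inj_on by blast
  show "\<exists>w \<in> words p. s = run D (initial D) w" if "s \<in> states D"
    using that RD by (auto simp: R_def)
  show "s = t" if "s \<in> states D" "t \<in> states D"
    "\<And>v. v \<in> words p \<Longrightarrow> out D (run D s v) = out D (run D t v)"
  proof -
    have "G s = G t" using that(3) by (auto simp: G_def fun_eq_iff)
    then show ?thesis using inj that(1,2) by (simp add: inj_on_eq_iff)
  qed
qed

lemma connecting_maps_exist: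
  assumes "prime p"
    and "\<And>n. a n \<in> padic_ints p"
    and "\<And>\<alpha>. minimal_automaton p (termwise (padic_proj \<alpha>) a) (M \<alpha>)"
  shows "\<exists>\<psi>. connecting_maps p M \<psi>"
proof -
  have D: "is_dao p (M \<alpha>)"
    and o: "\<And>w. w \<in> words p \<Longrightarrow> out (M \<alpha>) (run (M \<alpha>) (initial (M \<alpha>)) w) = a (word_val p w) \<alpha>" for \<alpha>
    using assms(3)[of \<alpha>]
    by (auto simp: minimal_automaton_def computes_def finite_dao_def termwise_def padic_proj_def)
  have coh: "zmod_proj p \<alpha> (a n \<beta>) = a n \<alpha>" if "\<alpha> \<le> \<beta>" for \<alpha> \<beta> n
    using assms(2)[of n] that by (simp add: padic_ints_def)
  define r where "r \<alpha> w = run (M \<alpha>) (initial (M \<alpha>)) w" for \<alpha> w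
  have ini: "r \<alpha> [] = initial (M \<alpha>)" for \<alpha> by (simp add: r_def run_def)
  have rS: "r \<alpha> w \<in> states (M \<alpha>)" if "w \<in> words p" for \<alpha> w
    using run_in_states[OF D that] D by (simp add: r_def is_dao_def)
  have reach: "\<exists>w \<in> words p. s = r \<alpha> w" if "s \<in> states (M \<alpha>)" for s \<alpha>
    using minimal_reachable_separated(1)[OF assms(3) that] by (simp add: r_def)
  have key: "r \<alpha> w = r \<alpha> w'"
    if "\<alpha> \<le> \<beta>" "w \<in> words p" "w' \<in> words p" "r \<beta> w = r \<beta> w'" for \<alpha> \<beta> w w'
  proof (rule minimal_reachable_separated(2)[OF assms(3) rS[OF that(2)] rS[OF that(3)]])
    fix v assume v: "v \<in> words p"
    have ap: "w @ v \<in> words p" "w' @ v \<in> words p" using v that by (auto simp: words_def)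
    have "r \<beta> (w @ v) = r \<beta> (w' @ v)" using that(4) by (simp add: r_def run_append)
    then have "a (word_val p (w @ v)) \<beta> = a (word_val p (w' @ v)) \<beta>"
      using o[OF ap(1)] o[OF ap(2)] by (metis r_def)
    then have "a (word_val p (w @ v)) \<alpha> = a (word_val p (w' @ v)) \<alpha>"
      using coh[OF that(1)] by metis
    then show "out (M \<alpha>) (run (M \<alpha>) (r \<alpha> w) v) = out (M \<alpha>) (run (M \<alpha>) (r \<alpha> w') v)"
      using o[OF ap(1)] o[OF ap(2)] by (simp add: r_def run_append)
  qed
  define \<psi> where "\<psi> \<alpha> \<beta> s = r \<alpha> (SOME w. w \<in> words p \<and> r \<beta> w = s)" for \<alpha> \<beta> s
  have psi: "\<psi> \<alpha> \<beta> (r \<beta> w) = r \<alpha> w" if "\<alpha> \<le> \<beta>" "w \<in> words p" for \<alpha> \<beta> w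
  proof -
    have "\<exists>x. x \<in> words p \<and> r \<beta> x = r \<beta> w" using that by blast
    from someI_ex[OF this] show ?thesis unfolding \<psi>_def using key[OF that(1) _ that(2)] by blast
  qed
  have nil: "[] \<in> words p" by (simp add: words_def)
  have "connecting_maps p M \<psi>"
    unfolding connecting_maps_def
  proof (intro conjI allI impI ballI)
    fix \<alpha> \<beta> :: nat assume ab: "\<alpha> \<le> \<beta>"
    show "\<psi> \<alpha> \<beta> \<in> states (M \<beta>) \<rightarrow> states (M \<alpha>)"
    proof
      fix s assume "s \<in> states (M \<beta>)"
      then show "\<psi> \<alpha> \<beta> s \<in> states (M \<alpha>)" using reach psi[OF ab] rS by metis
    qed
    show "\<psi> \<alpha> \<beta> (initial (M \<beta>)) = initial (M \<alpha>)" using psi[OF ab nil] by (simp add: ini)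
    fix s assume s: "s \<in> states (M \<beta>)"
    then obtain w where w: "w \<in> words p" "s = r \<beta> w" using reach by blast
    show "zmod_proj p \<alpha> (out (M \<beta>) s) = out (M \<alpha>) (\<psi> \<alpha> \<beta> s)"
      using psi[OF ab w(1)] o[OF w(1)] coh[OF ab] w(2) by (simp add: r_def)
    fix i assume i: "i < p"
    have wi: "w @ [i] \<in> words p" using w i by (auto simp: words_def)
    have ri: "r \<gamma> (w @ [i]) = trans (M \<gamma>) (r \<gamma> w) i" for \<gamma> by (simp add: r_def run_def)
    show "\<psi> \<alpha> \<beta> (trans (M \<beta>) s i) = trans (M \<alpha>) (\<psi> \<alpha> \<beta> s) i"
      using psi[OF ab wi] psi[OF ab w(1)] w(2) by (simp add: ri)
  next
    fix \<alpha> \<beta> \<gamma> s assume l: "\<alpha> \<le> \<beta>" "\<beta> \<le> \<gamma>" and s: "s \<in> states (M \<gamma>)"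
    then obtain w where w: "w \<in> words p" "s = r \<gamma> w" using reach by blast
    have "\<alpha> \<le> \<gamma>" using l by simp
    then show "\<psi> \<alpha> \<gamma> s = \<psi> \<alpha> \<beta> (\<psi> \<beta> \<gamma> s)" using psi w l by simp
  qed
  then show ?thesis by blast
qed

end

theory Submission
  imports Defs
begin

text \<open>Every map in the diagram applies a continuous map of alphabets to each term. Such a map is
  continuous on sequences and commutes with the shift, so it sends the orbit closure of \<open>x\<close> into
  the orbit closure of the image of \<open>x\<close>; it remains to follow the generating sequences \<open>u\<close>, \<open>u\<^sub>\<alpha>\<close>,
  \<open>a\<close>, \<open>a\<^sub>\<alpha>\<close> around the diagram. Continuity of \<open>\<tau>\<close> holds because a map into the p-adic integers is
  continuous as soon as all its residues are.\<close>

section \<open>Termwise maps and orbit closures\<close>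

lemma termwise_shift: "termwise f (shift x) = shift (termwise f x)"
  by (simp add: fun_eq_iff termwise_def shift_def)

lemma termwise_shift_funpow: "termwise f ((shift ^^ n) x) = (shift ^^ n) (termwise f x)"
  by (induction n) (simp_all add: termwise_shift)

lemma commutes_with_shift_termwise: "commutes_with_shift X (termwise f)"
  by (simp add: commutes_with_shift_def termwise_shift)

text \<open>Puts the letters of every point of an orbit closure in the alphabet; the identities
  between the maps rest on properties that are known there only.\<close>

lemma shift_space_in_topspace: "x \<in> shift_space T u \<Longrightarrow> x n \<in> topspace T"
  using closure_of_subset_topspace[of "product_topology (\<lambda>_::nat. T) UNIV"]
  by (fastforce simp: shift_space_def)

text \<open>Continuity into a product is checked on coordinates, and the \<open>n\<close>-th
  coordinate of \<open>termwise f\<close> is the \<open>n\<close>-th projection followed by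
  \<open>f\<close>.\<close>

lemma continuous_map_termwise:
  assumes "continuous_map T U f"
  shows "continuous_map (product_topology (\<lambda>_. T) UNIV) (product_topology (\<lambda>_. U) UNIV) (termwise f)"
proof -
  have "continuous_map (product_topology (\<lambda>_. T) UNIV) U (\<lambda>x. termwise f x n)" for n
    using continuous_map_compose[OF continuous_map_product_projection[of n UNIV "\<lambda>_. T"] assms]
    by (simp add: termwise_def o_def)
  then show ?thesis by (simp add: continuous_map_componentwise_UNIV)
qed

text \<open>A continuous map sends the closure of a set into the closure of its image, and the image
  of the orbit of \<open>x\<close> is the orbit of \<open>termwise f x\<close>.\<close>

lemma termwise_shift_space:
  assumes "continuous_map T U f"
  shows "termwise f \<in> shift_space T x \<rightarrow> shift_space U (termwise f x)"
proof -
  have "termwise f ` range (\<lambda>n. (shift ^^ n) x) = range (\<lambda>n. (shift ^^ n) (termwise f x))"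
    by (simp add: image_image termwise_shift_funpow)
  then show ?thesis
    using continuous_map_image_closure_subset[OF continuous_map_termwise[OF assms],
        of "range (\<lambda>n. (shift ^^ n) x)"]
    by (auto simp: shift_space_def)
qed

section \<open>The p-adic topology in terms of residues\<close>

text \<open>Closed balls of radius \<open>1 / p ^ n\<close> are the residue classes modulo
  \<open>p ^ n\<close>: for distinct points, agreement at \<open>n\<close> means that
  \<open>n\<close> is at most the valuation of the difference, and powers of \<open>p > 1\<close>
  reverse this order in the radii. Equal points are treated apart, as they have no finite
  valuation.\<close>

lemma padic_dist_le_iff:
  assumes "prime p" "x \<in> padic_ints p" "y \<in> padic_ints p"
  shows "padic_dist p x y \<le> 1 / real p ^ n \<longleftrightarrow> x n = y n"
proof (cases "x = y")
  case False
  have p: "real p > 1" using prime_gt_1_nat[OF assms(1)] by simp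
  then have "(1 / real p ^ k \<le> 1 / real p ^ n) = (n \<le> k)" for k
    by (simp add: divide_simps)
  then have "padic_dist p x y \<le> 1 / real p ^ n \<longleftrightarrow> n \<le> (GREATEST n. x n = y n)"
    using False by (simp add: padic_dist_def)
  then show ?thesis by (simp only: padic_greatest[OF assms(2,3) False, of n])
qed (simp add: padic_dist_def)

lemma topspace_padic_topology: "prime p \<Longrightarrow> topspace (padic_topology p) = padic_ints p"
  by (simp add: padic_topology_def Metric_space.topspace_mtopology padic_Metric_space)

text \<open>The open ball of radius \<open>1 / p ^ \<alpha>\<close> around \<open>x\<close> lies in
  the closed ball, that is, in the residue class of \<open>x\<close>. So every preimage of a set of
  residues is open.\<close>

lemma continuous_map_padic_proj:
  assumes "prime p"
  shows "continuous_map (padic_topology p) (discrete_topology (zmod p \<alpha>)) (padic_proj \<alpha>)"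
proof -
  interpret Metric_space "padic_ints p" "padic_dist p" by (rule padic_Metric_space[OF assms])
  have p: "real p > 0" using prime_gt_0_nat[OF assms] by simp
  have "openin mtopology {x \<in> padic_ints p. padic_proj \<alpha> x \<in> U}" for U
    unfolding openin_mtopology
  proof (intro conjI allI impI)
    fix x assume "x \<in> {x \<in> padic_ints p. padic_proj \<alpha> x \<in> U}"
    then have "mball x (1 / real p ^ \<alpha>) \<subseteq> {x \<in> padic_ints p. padic_proj \<alpha> x \<in> U}"
      using padic_dist_le_iff[OF assms, of x _ \<alpha>] by (force simp: padic_proj_def)
    moreover have "1 / real p ^ \<alpha> > 0" using p by simp
    ultimately show "\<exists>r>0. mball x r \<subseteq> {x \<in> padic_ints p. padic_proj \<alpha> x \<in> U}" by blast
  qed auto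
  moreover have "padic_proj \<alpha> \<in> padic_ints p \<rightarrow> zmod p \<alpha>"
    by (auto simp: padic_ints_def padic_proj_def)
  ultimately show ?thesis by (simp add: continuous_map_def padic_topology_def)
qed

text \<open>Being close to \<open>f x\<close> within \<epsilon> only requires agreement modulo one
  power \<open>p ^ n\<close>, and this is an open condition because the residue map is continuous
  into a discrete space.\<close>

lemma continuous_map_into_padic:
  assumes "prime p" "f \<in> topspace X \<rightarrow> padic_ints p"
    and "\<And>\<alpha>. continuous_map X (discrete_topology (zmod p \<alpha>)) (padic_proj \<alpha> \<circ> f)"
  shows "continuous_map X (padic_topology p) f"
proof -
  interpret Metric_space "padic_ints p" "padic_dist p" by (rule padic_Metric_space[OF assms(1)])
  have p: "1 / real p < 1" "0 \<le> 1 / real p" using prime_gt_1_nat[OF assms(1)] by simp_all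
  show ?thesis
    unfolding padic_topology_def continuous_map_to_metric
  proof (intro ballI allI impI)
    fix x and \<epsilon> :: real assume x: "x \<in> topspace X" and e: "\<epsilon> > 0"
    obtain n where n: "(1 / real p) ^ n < \<epsilon>" using real_arch_pow_inv[OF e p(1)] by blast
    define U where "U = {y \<in> topspace X. (padic_proj n \<circ> f) y \<in> {f x n}}"
    \<comment> \<open>The singleton \<open>{f x n}\<close> is open in the discrete topology only as
      a subset of its carrier \<open>zmod p n\<close>.\<close>
    have "f x n \<in> zmod p n" using assms(2) x by (auto simp: padic_ints_def)
    then have "openin X U" unfolding U_def by (intro openin_continuous_map_preimage[OF assms(3)]) simp
    moreover have "x \<in> U" using x by (simp add: U_def padic_proj_def)
    moreover have "f y \<in> mball (f x) \<epsilon>" if "y \<in> U" for y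
    proof -
      have y: "y \<in> topspace X" "f x n = f y n" using that by (auto simp: U_def padic_proj_def)
      then have m: "f x \<in> padic_ints p" "f y \<in> padic_ints p" using assms(2) x by auto
      then have "padic_dist p (f x) (f y) \<le> 1 / real p ^ n"
        using padic_dist_le_iff[OF assms(1) m] y by simp
      then show ?thesis using n m by (simp add: power_one_over)
    qed
    ultimately show "\<exists>U. openin X U \<and> x \<in> U \<and> (\<forall>y\<in>U. f y \<in> mball (f x) \<epsilon>)" by blast
  qed
qed

section \<open>Base-p representations and generated sequences\<close>

lemma rep_in_words: "rep p n \<in> words p"
proof (induction p n rule: rep.induct)
  case (1 p n)
  then show ?case by (subst rep.simps) (auto simp: words_def)
qed

text \<open>Horner's rule: the appended digit is the least significant one, so it gets index 0 in
  the reversed word and moves all other digits up by one power of \<open>p\<close>.\<close>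

lemma word_val_snoc: "word_val p (w @ [i]) = word_val p w * p + i"
proof -
  have "word_val p (w @ [i]) = (\<Sum>j<Suc (length w). (i # rev w) ! j * p ^ j)"
    by (simp add: word_val_def)
  also have "\<dots> = i + (\<Sum>j<length w. rev w ! j * p ^ Suc j)"
    by (subst sum.lessThan_Suc_shift) simp
  also have "(\<Sum>j<length w. rev w ! j * p ^ Suc j) = word_val p w * p"
    unfolding word_val_def sum_distrib_right by (rule sum.cong) simp_all
  finally show ?thesis by simp
qed

lemma word_val_rep: "p \<ge> 2 \<Longrightarrow> word_val p (rep p n) = n"
proof (induction p n rule: rep.induct)
  case (1 p n)
  show ?case
  proof (cases "n = 0")
    case True
    then have "rep p n = []" by (subst rep.simps) simp
    then show ?thesis using True by (simp add: word_val_def)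
  next
    case False
    then have "rep p n = rep p (n div p) @ [n mod p]" using 1(2) by (simp add: rep.simps[of p n])
    then show ?thesis using 1 False by (simp add: word_val_snoc)
  qed
qed

text \<open>Passes from \<open>computes\<close>, which concerns all words including those with
  leading zeros, to the terms of the sequence: \<open>rep p n\<close> is one word of value
  \<open>n\<close>.\<close>

lemma out_state_seq:
  assumes "p \<ge> 2" "computes p b D"
  shows "out D (state_seq p D n) = b n"
  using assms rep_in_words by (simp add: computes_def state_seq_def word_val_rep)

lemma state_seq_in_states: "is_dao p D \<Longrightarrow> state_seq p D n \<in> states D"
  unfolding state_seq_def by (rule run_in_states[OF _ rep_in_words]) (simp_all add: is_dao_def)

section \<open>The inverse limit as an automaton\<close>

lemma run_inverse_limit: "run (inverse_limit p M \<psi>) s w \<alpha> = run (M \<alpha>) (s \<alpha>) w"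
  by (induction w arbitrary: s) (simp_all add: run_def inverse_limit_def)

lemma state_seq_inverse_limit: "state_seq p (inverse_limit p M \<psi>) n \<alpha> = state_seq p (M \<alpha>) n"
  by (simp add: state_seq_def run_inverse_limit) (simp add: inverse_limit_def)

text \<open>The three compatibility conditions on the connecting maps give, in turn, coherence of
  the initial state, coherence of successor states, and coherence of the residues of an output,
  which is thus a p-adic integer.\<close>

lemma is_dao_inverse_limit:
  assumes "connecting_maps p M \<psi>" "\<And>\<alpha>. is_dao p (M \<alpha>)" "\<And>\<alpha>. alphabet (M \<alpha>) = zmod p \<alpha>"
  shows "is_dao p (inverse_limit p M \<psi>)"
proof -
  have psi: "\<psi> \<alpha> \<beta> (initial (M \<beta>)) = initial (M \<alpha>)"
    "\<And>s i. s \<in> states (M \<beta>) \<Longrightarrow> i < p \<Longrightarrow> \<psi> \<alpha> \<beta> (trans (M \<beta>) s i) = trans (M \<alpha>) (\<psi> \<alpha> \<beta> s) i"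
    "\<And>s. s \<in> states (M \<beta>) \<Longrightarrow> zmod_proj p \<alpha> (out (M \<beta>) s) = out (M \<alpha>) (\<psi> \<alpha> \<beta> s)"
    if "\<alpha> \<le> \<beta>" for \<alpha> \<beta>
    using assms(1) that unfolding connecting_maps_def by blast+
  have D: "initial (M \<alpha>) \<in> states (M \<alpha>)"
    "\<And>s i. s \<in> states (M \<alpha>) \<Longrightarrow> i < p \<Longrightarrow> trans (M \<alpha>) s i \<in> states (M \<alpha>)"
    "\<And>s. s \<in> states (M \<alpha>) \<Longrightarrow> out (M \<alpha>) s \<in> zmod p \<alpha>" for \<alpha>
    using assms(2)[of \<alpha>] assms(3)[of \<alpha>] by (auto simp: is_dao_def)
  show ?thesis
    by (auto simp: is_dao_def inverse_limit_def padic_ints_def psi D)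
qed

section \<open>Continuity of the maps out of the inverse limit\<close>

lemma topspace_limit_topology:
  "topspace (limit_topology p M \<psi>) = states (inverse_limit p M \<psi>)"
  by (auto simp: limit_topology_def inverse_limit_def)

lemma continuous_map_psi_inf:
  "continuous_map (limit_topology p M \<psi>) (discrete_topology (states (M \<alpha>))) (psi_inf \<alpha>)"
proof -
  have "psi_inf \<alpha> = (\<lambda>s :: nat \<Rightarrow> 'a. s \<alpha>)" by (simp add: fun_eq_iff psi_inf_def)
  then show ?thesis
    using continuous_map_product_projection[of \<alpha> UNIV "\<lambda>\<alpha>. discrete_topology (states (M \<alpha>))"]
    by (simp add: limit_topology_def continuous_map_from_subtopology)
qed

text \<open>It suffices to look at residues. The residue modulo \<open>p ^ \<alpha>\<close> of the
  output depends only on component \<alpha> of the state, so it factors through the discrete set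
  \<open>states (M \<alpha>)\<close>.\<close>

lemma continuous_map_out_inverse_limit:
  assumes "prime p" "connecting_maps p M \<psi>" "\<And>\<alpha>. is_dao p (M \<alpha>)"
    and "\<And>\<alpha>. alphabet (M \<alpha>) = zmod p \<alpha>"
  shows "continuous_map (limit_topology p M \<psi>) (padic_topology p) (out (inverse_limit p M \<psi>))"
proof (rule continuous_map_into_padic[OF assms(1)])
  show "out (inverse_limit p M \<psi>) \<in> topspace (limit_topology p M \<psi>) \<rightarrow> padic_ints p"
    using is_dao_inverse_limit[OF assms(2-)]
    by (simp add: topspace_limit_topology is_dao_def) (auto simp: inverse_limit_def)
  fix \<alpha>
  have "padic_proj \<alpha> \<circ> out (inverse_limit p M \<psi>) = out (M \<alpha>) \<circ> psi_inf \<alpha>"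
    by (simp add: fun_eq_iff padic_proj_def psi_inf_def inverse_limit_def)
  moreover have
    "continuous_map (discrete_topology (states (M \<alpha>))) (discrete_topology (zmod p \<alpha>)) (out (M \<alpha>))"
    using assms(3)[of \<alpha>] assms(4)[of \<alpha>] by (auto simp: is_dao_def)
  ultimately show "continuous_map (limit_topology p M \<psi>) (discrete_topology (zmod p \<alpha>))
      (padic_proj \<alpha> \<circ> out (inverse_limit p M \<psi>))"
    using continuous_map_compose[OF continuous_map_psi_inf] by metis
qed

section \<open>The commuting diagram of shift spaces\<close>

theorem theorem4p1:
  fixes p :: nat
    and a :: "nat \<Rightarrow> nat \<Rightarrow> int"
    and M :: "nat \<Rightarrow> ('s, int) dao"
    and \<psi> :: "nat \<Rightarrow> nat \<Rightarrow> 's \<Rightarrow> 's"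
  assumes "prime p"
    and "\<And>n. a n \<in> padic_ints p"
    and "\<And>\<alpha>. p_automatic p (termwise (padic_proj \<alpha>) a)"
    and "\<And>\<alpha>. minimal_automaton p (termwise (padic_proj \<alpha>) a) (M \<alpha>)"
    and "\<And>\<alpha>. alphabet (M \<alpha>) = zmod p \<alpha>"
    and "connecting_maps p M \<psi>"
  shows "let S = inverse_limit p M \<psi>;
             a' = (\<lambda>\<alpha>. termwise (padic_proj \<alpha>) a);
             u' = (\<lambda>\<alpha>. state_seq p (M \<alpha>));
             Xa = shift_space (padic_topology p) a;
             Xa' = (\<lambda>\<alpha>. shift_space (discrete_topology (zmod p \<alpha>)) (a' \<alpha>));
             Xu' = (\<lambda>\<alpha>. shift_space (discrete_topology (states (M \<alpha>))) (u' \<alpha>));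
             psi' = (\<lambda>\<alpha> \<beta>. termwise (\<psi> \<alpha> \<beta>));
             psi_oo = (\<lambda>\<alpha>. termwise (psi_inf \<alpha>));
             pi' = (\<lambda>\<alpha>. termwise (zmod_proj p \<alpha>));
             pi_oo = (\<lambda>\<alpha>. termwise (padic_proj \<alpha>));
             tau' = (\<lambda>\<alpha>. termwise (out (M \<alpha>)))
         in \<exists>u \<tau>. let Xu = shift_space (limit_topology p M \<psi>) u in
              (\<forall>n. u n \<in> states S) \<and> u = state_seq p S \<and>
              letter_to_letter (states S) (padic_ints p) \<tau> \<and> \<tau> \<in> Xu \<rightarrow> Xa \<and> \<tau> u = a \<and>
              commutes_with_shift Xu \<tau> \<and>
              (\<forall>\<alpha> \<beta>. \<alpha> \<le> \<beta> \<longrightarrow>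
                 psi_oo \<alpha> \<in> Xu \<rightarrow> Xu' \<alpha> \<and> psi_oo \<beta> \<in> Xu \<rightarrow> Xu' \<beta> \<and> psi' \<alpha> \<beta> \<in> Xu' \<beta> \<rightarrow> Xu' \<alpha> \<and>
                 tau' \<alpha> \<in> Xu' \<alpha> \<rightarrow> Xa' \<alpha> \<and> tau' \<beta> \<in> Xu' \<beta> \<rightarrow> Xa' \<beta> \<and>
                 pi_oo \<alpha> \<in> Xa \<rightarrow> Xa' \<alpha> \<and> pi_oo \<beta> \<in> Xa \<rightarrow> Xa' \<beta> \<and> pi' \<alpha> \<in> Xa' \<beta> \<rightarrow> Xa' \<alpha> \<and>
                 commutes_with_shift Xu (psi_oo \<alpha>) \<and> commutes_with_shift Xu (psi_oo \<beta>) \<and>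
                 commutes_with_shift (Xu' \<beta>) (psi' \<alpha> \<beta>) \<and>
                 commutes_with_shift (Xu' \<alpha>) (tau' \<alpha>) \<and> commutes_with_shift (Xu' \<beta>) (tau' \<beta>) \<and>
                 commutes_with_shift Xa (pi_oo \<alpha>) \<and> commutes_with_shift Xa (pi_oo \<beta>) \<and>
                 commutes_with_shift (Xa' \<beta>) (pi' \<alpha>) \<and>
                 (\<forall>x \<in> Xu. psi_oo \<alpha> x = psi' \<alpha> \<beta> (psi_oo \<beta> x)) \<and>
                 (\<forall>y \<in> Xa. pi_oo \<alpha> y = pi' \<alpha> (pi_oo \<beta> y)) \<and>
                 (\<forall>x \<in> Xu' \<beta>. pi' \<alpha> (tau' \<beta> x) = tau' \<alpha> (psi' \<alpha> \<beta> x)) \<and>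
                 (\<forall>x \<in> Xu. pi_oo \<alpha> (\<tau> x) = tau' \<alpha> (psi_oo \<alpha> x)) \<and>
                 (\<forall>x \<in> Xu. pi_oo \<beta> (\<tau> x) = tau' \<beta> (psi_oo \<beta> x)))"
proof -
  define S where "S = inverse_limit p M \<psi>"
  define u where "u = state_seq p S"
  define \<tau> where "\<tau> = termwise (out S)"
  define a' where "a' \<alpha> = termwise (padic_proj \<alpha>) a" for \<alpha>
  define u' where "u' \<alpha> = state_seq p (M \<alpha>)" for \<alpha>
  let ?Xu = "shift_space (limit_topology p M \<psi>) u"
  let ?Xa = "shift_space (padic_topology p) a"
  let ?Xu' = "\<lambda>\<alpha>. shift_space (discrete_topology (states (M \<alpha>))) (u' \<alpha>)"
  let ?Xa' = "\<lambda>\<alpha>. shift_space (discrete_topology (zmod p \<alpha>)) (a' \<alpha>)"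
  have p: "p \<ge> 2" using prime_ge_2_nat[OF assms(1)] .
  have comp: "computes p (a' \<alpha>) (M \<alpha>)" for \<alpha>
    using assms(4)[of \<alpha>] by (simp add: minimal_automaton_def a'_def)
  then have D: "is_dao p (M \<alpha>)" for \<alpha>
    by (simp add: computes_def finite_dao_def)
  have DS: "is_dao p S"
    unfolding S_def by (rule is_dao_inverse_limit[OF assms(6) D assms(5)])
  have psi: "\<psi> \<alpha> \<beta> \<in> states (M \<beta>) \<rightarrow> states (M \<alpha>)"
    and psi_out: "\<And>s. s \<in> states (M \<beta>) \<Longrightarrow> zmod_proj p \<alpha> (out (M \<beta>) s) = out (M \<alpha>) (\<psi> \<alpha> \<beta> s)"
    if "\<alpha> \<le> \<beta>" for \<alpha> \<beta>
    using assms(6) that unfolding connecting_maps_def by blast+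
  have u_psi_inf: "termwise (psi_inf \<alpha>) u = u' \<alpha>" for \<alpha>
    by (simp add: fun_eq_iff termwise_def psi_inf_def u_def u'_def S_def state_seq_inverse_limit)
  have uS: "u n \<in> states S" for n
    unfolding u_def by (rule state_seq_in_states[OF DS])
  \<comment> \<open>Each \<open>u n\<close> is a state of the limit and has components
    \<open>u' \<alpha> n\<close>, so the claim is the coherence of \<open>u n\<close>.\<close>
  have u_psi: "termwise (\<psi> \<alpha> \<beta>) (u' \<beta>) = u' \<alpha>" if "\<alpha> \<le> \<beta>" for \<alpha> \<beta>
    using uS that
    by (auto simp: fun_eq_iff termwise_def psi_inf_def S_def inverse_limit_def simp flip: u_psi_inf)
  have u_out: "termwise (out (M \<alpha>)) (u' \<alpha>) = a' \<alpha>" for \<alpha>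
    using out_state_seq[OF p comp] by (simp add: fun_eq_iff termwise_def u'_def)
  have out_S: "out S s \<alpha> = out (M \<alpha>) (s \<alpha>)" for s \<alpha>
    by (simp add: S_def inverse_limit_def)
  \<comment> \<open>Equality of p-adic integers is checked residue by residue; at level \<alpha> it
    says that \<open>M \<alpha>\<close> generates \<open>a' \<alpha>\<close>.\<close>
  have u_tau: "\<tau> u = a"
  proof (intro ext)
    fix n \<alpha>
    show "\<tau> u n \<alpha> = a n \<alpha>"
      using fun_cong[OF u_out[of \<alpha>], of n] fun_cong[OF u_psi_inf[of \<alpha>], of n]
      by (simp add: termwise_def psi_inf_def \<tau>_def out_S a'_def padic_proj_def)
  qed
  have a_proj: "termwise (zmod_proj p \<alpha>) (a' \<beta>) = a' \<alpha>" if "\<alpha> \<le> \<beta>" for \<alpha> \<beta>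
    using assms(2) that by (simp add: fun_eq_iff a'_def termwise_def padic_proj_def padic_ints_def)
  have zmod_proj: "zmod_proj p \<alpha> \<in> zmod p \<beta> \<rightarrow> zmod p \<alpha>" for \<alpha> \<beta>
    using p by (auto simp: zmod_proj_def zmod_def)
  have out_M: "out (M \<alpha>) \<in> states (M \<alpha>) \<rightarrow> zmod p \<alpha>" for \<alpha>
    using D[of \<alpha>] assms(5)[of \<alpha>] by (auto simp: is_dao_def)
  have Xu: "x n \<in> states S" if "x \<in> ?Xu" for x n
    using shift_space_in_topspace[OF that] by (simp add: topspace_limit_topology S_def)
  have Xa: "x n \<in> padic_ints p" if "x \<in> ?Xa" for x n
    using shift_space_in_topspace[OF that] by (simp add: topspace_padic_topology[OF assms(1)])
  have Xu': "x n \<in> states (M \<alpha>)" if "x \<in> ?Xu' \<alpha>" for x n \<alpha>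
    using shift_space_in_topspace[OF that] by simp
  have letter: "letter_to_letter (states S) (padic_ints p) \<tau>"
    using DS by (auto simp: letter_to_letter_def \<tau>_def is_dao_def S_def inverse_limit_def)
  have tau_maps: "\<tau> \<in> ?Xu \<rightarrow> ?Xa"
    using termwise_shift_space[OF continuous_map_out_inverse_limit[OF assms(1,6) D assms(5)], of u]
    unfolding S_def[symmetric] \<tau>_def[symmetric] u_tau .
  have psi_inf_maps: "termwise (psi_inf \<alpha>) \<in> ?Xu \<rightarrow> ?Xu' \<alpha>" for \<alpha>
    using termwise_shift_space[OF continuous_map_psi_inf] u_psi_inf by metis
  have psi_maps: "termwise (\<psi> \<alpha> \<beta>) \<in> ?Xu' \<beta> \<rightarrow> ?Xu' \<alpha>" if "\<alpha> \<le> \<beta>" for \<alpha> \<beta>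
    using termwise_shift_space[of "discrete_topology (states (M \<beta>))"
        "discrete_topology (states (M \<alpha>))" "\<psi> \<alpha> \<beta>" "u' \<beta>"] psi[OF that] u_psi[OF that]
    by auto
  have out_maps: "termwise (out (M \<alpha>)) \<in> ?Xu' \<alpha> \<rightarrow> ?Xa' \<alpha>" for \<alpha>
    using termwise_shift_space[of "discrete_topology (states (M \<alpha>))"
        "discrete_topology (zmod p \<alpha>)" "out (M \<alpha>)" "u' \<alpha>"] out_M u_out
    by auto
  have padic_proj_maps: "termwise (padic_proj \<alpha>) \<in> ?Xa \<rightarrow> ?Xa' \<alpha>" for \<alpha>
    unfolding a'_def by (rule termwise_shift_space[OF continuous_map_padic_proj[OF assms(1)]])
  have zmod_proj_maps: "termwise (zmod_proj p \<alpha>) \<in> ?Xa' \<beta> \<rightarrow> ?Xa' \<alpha>" if "\<alpha> \<le> \<beta>" for \<alpha> \<beta>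
    using termwise_shift_space[of "discrete_topology (zmod p \<beta>)"
        "discrete_topology (zmod p \<alpha>)" "zmod_proj p \<alpha>" "a' \<beta>"] zmod_proj a_proj[OF that]
    by auto
  \<comment> \<open>The letters of \<open>x\<close> are states of the limit, and coherence of such a
    state is the required identity at each term. The next identity follows likewise from coherence
    of p-adic integers.\<close>
  have psi_inf_comp: "termwise (psi_inf \<alpha>) x = termwise (\<psi> \<alpha> \<beta>) (termwise (psi_inf \<beta>) x)"
    if "\<alpha> \<le> \<beta>" "x \<in> ?Xu" for \<alpha> \<beta> x
    using Xu[OF that(2)] that(1)
    by (simp add: fun_eq_iff termwise_def psi_inf_def S_def inverse_limit_def)
  have padic_proj_comp:
    "termwise (padic_proj \<alpha>) y = termwise (zmod_proj p \<alpha>) (termwise (padic_proj \<beta>) y)"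
    if "\<alpha> \<le> \<beta>" "y \<in> ?Xa" for \<alpha> \<beta> y
    using Xa[OF that(2)] that(1)
    by (simp add: fun_eq_iff termwise_def padic_proj_def padic_ints_def)
  have out_comp: "termwise (zmod_proj p \<alpha>) (termwise (out (M \<beta>)) x) =
      termwise (out (M \<alpha>)) (termwise (\<psi> \<alpha> \<beta>) x)"
    if "\<alpha> \<le> \<beta>" "x \<in> ?Xu' \<beta>" for \<alpha> \<beta> x
    using psi_out[OF that(1) Xu'[OF that(2)]] by (simp add: fun_eq_iff termwise_def)
  \<comment> \<open>This holds for every sequence \<open>x\<close>, since the output of the limit is
    defined componentwise; it covers both the level \<alpha> and the level \<beta>.\<close>
  have tau_comp: "termwise (padic_proj \<alpha>) (\<tau> x) = termwise (out (M \<alpha>)) (termwise (psi_inf \<alpha>) x)"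
    for \<alpha> x
    by (simp add: fun_eq_iff termwise_def \<tau>_def padic_proj_def psi_inf_def out_S)
  have tau_commutes: "commutes_with_shift ?Xu \<tau>"
    unfolding \<tau>_def by (rule commutes_with_shift_termwise)
  show ?thesis
    unfolding Let_def S_def[symmetric] a'_def[symmetric] u'_def[symmetric]
    by (intro exI[of _ u] exI[of _ \<tau>] conjI allI impI ballI uS u_def letter tau_maps u_tau
        tau_commutes psi_inf_maps psi_maps out_maps padic_proj_maps zmod_proj_maps
        commutes_with_shift_termwise psi_inf_comp padic_proj_comp out_comp tau_comp)
qed

end
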